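(* Let $d \ge 1$ be an integer and let $G$ be a graph with $n \ge 5$ nodes and edge weights $\mathbf{g}_{\{i,j\}} = (g^1_{\{i,j\}}, \ldots, g^d_{\{i,j\}}) \in \mathbb{R}^d$ ($i \ne j$). Suppose that for every pairwise distinct $i,j,k \in \{1,\ldots,n\}$ and every pairwise distinct $m,p,q,r \in \{1,\ldots,n\}$ we have $$g^l_{\{i,j\}} + g^l_{\{j,k\}} \ne g^l_{\{m,p\}} + g^l_{\{q,r\}} \quad \text{for all } l = 1,\ldots,d,$$ and $$g^l_{\{i,j\}} + g^{l+1}_{\{j,k\}} \ne g^l_{\{m,p\}} + g^{l+1}_{\{q,r\}} \quad \text{for all } l = 1,\ldots,d-1.$$ Then $G$ is reconstructible from the following $3d-1$ distributions: $\mathcal{D}_{g^l}(G)$ for $l = 1,\ldots,d$; $\mathcal{D}_{\alpha^l}(G)$ for $l=1,\ldots,d$; and $\mathcal{D}_{\alpha^{l,l+1}}(G)$ for $l = 1,\ldots,d-1$. That is, every graph $G'$ with $n$ nodes and edge weights in $\mathbb{R}^d$ for which each of these $3d-1$ distributions coincides with the corresponding one for $G$ is isomorphic to $G$.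
   Context: Here a graph $G$ with $n$ nodes and edge weights in $\mathbb{R}^d$ is a complete graph on $\{1,\ldots,n\}$ with a weight $\mathbf{g}_{\{i,j\}} = (g^1_{\{i,j\}}, \ldots, g^d_{\{i,j\}}) \in \mathbb{R}^d$ assigned to each two-element subset $\{i,j\}$ (no node weights). Two such graphs with weights $\mathbf{g}_{\{i,j\}}$ and $\mathbf{g}'_{\{i,j\}}$ are isomorphic if there is a permutation $\pi \in S_n$ with $\mathbf{g}'_{\{i,j\}} = \mathbf{g}_{\{\pi(i),\pi(j)\}}$ for all $i \ne j$. A distribution means a multiset, i.e. a set with a positive integer multiplicity for each element. $\mathcal{D}_{g^l}(G)$ is the multiset of all $g^l_{\{i,j\}}$ over the two-element subsets $\{i,j\} \subseteq \{1,\ldots,n\}$. For pairwise distinct $i,j,k$ put $$\alpha^l_{i,j,k} = g^l_{\{i,j\}} + g^l_{\{j,k\}} \ (l=1,\ldots,d), \qquad \alpha^{l,l+1}_{i,j,k} = g^l_{\{i,j\}} + g^{l+1}_{\{j,k\}} \ (l = 1,\ldots,d-1).$$ $\mathcal{D}_{\alpha^l}(G)$ and $\mathcal{D}_{\alpha^{l,l+1}}(G)$ are the multisets of all $\alpha^l_{i,j,k}$ and of all $\alpha^{l,l+1}_{i,j,k}$, respectively, taken over all pairwise distinct $i,j,k \in \{1,\ldots,n\}$. *)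

theory Defs
  imports Complex_Main "HOL-Library.Multiset" "HOL-Combinatorics.Permutations"
begin

text \<open>
  A graph with nodes \<open>{1..n}\<close> and edge weights in \<open>\<real>\<^sup>d\<close> is given by a function \<open>g\<close>, where
  \<open>g {i, j} l\<close> is the \<open>l\<close>-th coordinate of the weight of the edge \<open>{i, j}\<close>. The coordinates are
  explicit numbers because consecutive ones are combined. All notions below look at \<open>g\<close> only on
  two-element subsets of \<open>{1..n}\<close> and coordinates in \<open>{1..d}\<close>; its other values are irrelevant.
\<close>

type_synonym edge_weights = "nat set \<Rightarrow> nat \<Rightarrow> real"

definition edges :: "nat \<Rightarrow> nat set set" where
  "edges n = {e. e \<subseteq> {1..n} \<and> card e = 2}"

definition triples :: "nat \<Rightarrow> (nat \<times> nat \<times> nat) set" where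
  "triples n = {(i, j, k). {i, j, k} \<subseteq> {1..n} \<and> distinct [i, j, k]}"

definition isomorphic :: "nat \<Rightarrow> nat \<Rightarrow> edge_weights \<Rightarrow> edge_weights \<Rightarrow> bool" where
  "isomorphic n d g g' \<longleftrightarrow>
     (\<exists>\<pi>. \<pi> permutes {1..n} \<and>
       (\<forall>i\<in>{1..n}. \<forall>j\<in>{1..n}. i \<noteq> j \<longrightarrow> (\<forall>l\<in>{1..d}. g' {i, j} l = g {\<pi> i, \<pi> j} l)))"

text \<open>\<open>alpha l l\<close> is \<open>\<alpha>\<^sup>l\<close>, and \<open>alpha l (l + 1)\<close> is the mixed sum \<open>\<alpha>\<close> with upper indices \<open>l, l + 1\<close>.\<close>

definition alpha :: "nat \<Rightarrow> nat \<Rightarrow> edge_weights \<Rightarrow> nat \<Rightarrow> nat \<Rightarrow> nat \<Rightarrow> real" where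
  "alpha l l' g i j k = g {i, j} l + g {j, k} l'"

definition edge_distribution :: "nat \<Rightarrow> nat \<Rightarrow> edge_weights \<Rightarrow> real multiset" where
  "edge_distribution n l g = {# g e l. e \<in># mset_set (edges n) #}"

text \<open>The triples are ordered, so a sum that is symmetric in \<open>i\<close> and \<open>k\<close> is counted twice.\<close>

definition alpha_distribution :: "nat \<Rightarrow> nat \<Rightarrow> nat \<Rightarrow> edge_weights \<Rightarrow> real multiset" where
  "alpha_distribution n l l' g = {# alpha l l' g i j k. (i, j, k) \<in># mset_set (triples n) #}"

definition reconstructible ::
    "nat \<Rightarrow> nat \<Rightarrow> edge_weights \<Rightarrow> (edge_weights \<Rightarrow> real multiset) set \<Rightarrow> bool" where
  "reconstructible n d g Ds \<longleftrightarrow>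
     (\<forall>g'. (\<forall>D\<in>Ds. D g' = D g) \<longrightarrow> isomorphic n d g g')"

end

theory Submission
  imports Defs "HOL-Library.Ramsey"
begin

text \<open>
  Equality of the distributions of \<open>g\<^sup>l\<close> provides, for each coordinate \<open>l\<close> separately, a permutation
  \<open>\<phi>\<close> of the set of edges with \<open>g'\<^sup>l(e) = g\<^sup>l(\<phi> e)\<close>. It need not come from a permutation of the nodes.
  But for adjacent edges \<open>e, f\<close> the sum \<open>g\<^sup>l(\<phi> e) + g\<^sup>l(\<phi> f)\<close> is a value of \<open>\<alpha>\<^sup>l\<close> on \<open>G'\<close>, hence also on
  \<open>G\<close>, and the hypothesis says that a sum over two disjoint edges of \<open>G\<close> is never such a value. So
  \<open>\<phi>\<close> preserves adjacency (lemma \<open>edges_meet\<close>), and a theorem of Whitney on line graphs of complete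
  graphs (lemma \<open>adjacency_preserving_induced\<close>) shows that \<open>\<phi>\<close> is induced by a permutation
  \<open>\<pi>\<^sub>l\<close> of the nodes.

  It remains to see that \<open>\<pi>\<^sub>l\<close> does not depend on \<open>l\<close>. The same argument with the mixed sums shows that
  the image of \<open>{i, j}\<close> under \<open>\<pi>\<^sub>l\<close> always meets the image of \<open>{j, k}\<close> under the permutation for
  \<open>l + 1\<close>. With at least five nodes there is enough room to choose \<open>i\<close> and \<open>k\<close> such that the common
  point can only be the image of \<open>j\<close> under both permutations, so consecutive permutations
  coincide (lemma \<open>permutations_eq_if_images_meet\<close>).
\<close>

section \<open>Adjacency-preserving maps between pairs\<close>

text \<open>
  If two members \<open>{a, b}\<close> and \<open>{a, c}\<close> and a third one avoiding \<open>a\<close> meet pairwise, the third one is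
  \<open>{b, c}\<close>, and then there is no room for a member outside the triangle \<open>a, b, c\<close>. The triangle
  itself has only three edges.
\<close>

lemma intersecting_pairs_common_point:
  assumes pairs: "\<And>A. A \<in> F \<Longrightarrow> card A = 2"
    and meet: "\<And>A B. A \<in> F \<Longrightarrow> B \<in> F \<Longrightarrow> A \<inter> B \<noteq> {}"
    and card: "card F \<ge> 4"
  shows "\<exists>c. \<forall>A\<in>F. c \<in> A"
proof (rule ccontr)
  assume no_common: "\<nexists>c. \<forall>A\<in>F. c \<in> A"
  from no_common obtain A where "A \<in> F" by blast
  from pairs[OF this] obtain x y where A: "A = {x, y}" "x \<noteq> y"
    by (auto simp: card_2_iff)
  from no_common obtain B where "B \<in> F" "y \<notin> B" by blast
  have "x \<in> B" using meet[OF \<open>A \<in> F\<close> \<open>B \<in> F\<close>] A \<open>y \<notin> B\<close> by auto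
  with pairs[OF \<open>B \<in> F\<close>] obtain z where B: "B = {x, z}" "x \<noteq> z"
    by (auto simp: card_2_iff)
  have "y \<noteq> z" using B \<open>y \<notin> B\<close> by auto
  from no_common obtain C where "C \<in> F" "x \<notin> C" by blast
  have "y \<in> C" "z \<in> C"
    using meet[OF \<open>A \<in> F\<close> \<open>C \<in> F\<close>] meet[OF \<open>B \<in> F\<close> \<open>C \<in> F\<close>] A B \<open>x \<notin> C\<close> by auto
  with pairs[OF \<open>C \<in> F\<close>] \<open>y \<noteq> z\<close> have C: "C = {y, z}"
    by (auto simp: card_2_iff)
  have "F \<subseteq> {{x, y}, {x, z}, {y, z}}"
  proof
    fix D assume "D \<in> F"
    from pairs[OF this] obtain u v where D: "D = {u, v}" "u \<noteq> v"
      by (auto simp: card_2_iff)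
    show "D \<in> {{x, y}, {x, z}, {y, z}}"
      using meet[OF \<open>D \<in> F\<close> \<open>A \<in> F\<close>] meet[OF \<open>D \<in> F\<close> \<open>B \<in> F\<close>] meet[OF \<open>D \<in> F\<close> \<open>C \<in> F\<close>]
      using A(2) B(2) D(2) \<open>y \<noteq> z\<close> unfolding A(1) B(1) C D(1)
      by (auto simp: doubleton_eq_iff)
  qed
  then have "card F \<le> card {{x, y}, {x, z}, {y, z}}" by (intro card_mono) auto
  also have "\<dots> \<le> 3" by (simp add: card_insert_if)
  finally show False using card by simp
qed

text \<open>
  This is the case of complete graphs in Whitney's theorem on isomorphisms of line graphs. The edges
  at a vertex \<open>i\<close> form an intersecting family of size at least four, so their images share a vertex
  \<open>\<pi> i\<close>. By counting, they are all the edges at \<open>\<pi> i\<close>; hence \<open>\<pi>\<close> is injective, and the image of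
  \<open>{i, j}\<close>, which contains \<open>\<pi> i\<close> and \<open>\<pi> j\<close>, has no further points. For four vertices the
  statement fails, since a triangle then has as many edges as there are edges at a vertex, and the
  two kinds of families can be exchanged.
\<close>

lemma adjacency_preserving_induced:
  assumes fin: "finite V" and card: "card V \<ge> 5"
    and maps: "\<And>e. e \<in> [V]\<^bsup>2\<^esup> \<Longrightarrow> \<phi> e \<in> [V]\<^bsup>2\<^esup>"
    and inj: "inj_on \<phi> ([V]\<^bsup>2\<^esup>)"
    and adj: "\<And>e f. e \<in> [V]\<^bsup>2\<^esup> \<Longrightarrow> f \<in> [V]\<^bsup>2\<^esup> \<Longrightarrow> e \<inter> f \<noteq> {} \<Longrightarrow> \<phi> e \<inter> \<phi> f \<noteq> {}"
  shows "\<exists>\<pi>. \<pi> permutes V \<and> (\<forall>i\<in>V. \<forall>j\<in>V. i \<noteq> j \<longrightarrow> \<phi> {i, j} = {\<pi> i, \<pi> j})"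
proof -
  define star where "star v = (\<lambda>j. {v, j}) ` (V - {v})" for v
  have star_sub: "star v \<subseteq> [V]\<^bsup>2\<^esup>" if "v \<in> V" for v
    using that by (auto simp: star_def)
  have star_iff: "e \<in> star v \<longleftrightarrow> e \<in> [V]\<^bsup>2\<^esup> \<and> v \<in> e" if "v \<in> V" for v e
    using that by (auto simp: star_def nsets_2_eq)
  have card_star: "card (star v) = card V - 1" if "v \<in> V" for v
  proof -
    have "inj_on (\<lambda>j. {v, j}) (V - {v})" by (auto simp: inj_on_def doubleton_eq_iff)
    then show ?thesis using that fin by (simp add: star_def card_image)
  qed
  have fin_star: "finite (star v)" for v using fin by (simp add: star_def)
  have card_image_star: "card (\<phi> ` star v) = card V - 1" if "v \<in> V" for v
    using card_star[OF that] inj_on_subset[OF inj star_sub[OF that]] by (simp add: card_image)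

  have "\<exists>c. \<forall>A\<in>\<phi> ` star v. c \<in> A" if "v \<in> V" for v
  proof (rule intersecting_pairs_common_point)
    fix A assume "A \<in> \<phi> ` star v"
    then show "card A = 2"
      using maps star_sub[OF that] by (auto simp: nsets_def)
  next
    fix A B assume "A \<in> \<phi> ` star v" "B \<in> \<phi> ` star v"
    then show "A \<inter> B \<noteq> {}"
      using adj star_iff[OF that] by blast
  next
    show "card (\<phi> ` star v) \<ge> 4" using card_image_star[OF that] card by simp
  qed
  then obtain c where c: "\<And>v A. v \<in> V \<Longrightarrow> A \<in> \<phi> ` star v \<Longrightarrow> c v \<in> A"
    by metis
  have c_in: "c i \<in> \<phi> {i, j}" "c j \<in> \<phi> {i, j}" if "i \<in> V" "j \<in> V" "i \<noteq> j" for i j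
    using that by (auto intro!: c simp: star_iff)
  have c_V: "c i \<in> V" if "i \<in> V" for i
  proof -
    have "\<not> V \<subseteq> {i}" using card card_mono[of "{i}" V] by auto
    then obtain j where "j \<in> V" "j \<noteq> i" by auto
    then show ?thesis
      using c_in(1)[of i j] maps[of "{i, j}"] that by (auto simp: nsets_def)
  qed
  have image_star: "\<phi> ` star i = star (c i)" if "i \<in> V" for i
  proof (rule card_subset_eq[OF fin_star])
    show "\<phi> ` star i \<subseteq> star (c i)"
      using that c c_V maps star_iff by auto
    show "card (\<phi> ` star i) = card (star (c i))"
      using card_image_star[OF that] card_star[OF c_V[OF that]] by simp
  qed
  have inj_c: "inj_on c V"
  proof
    fix i j assume ij: "i \<in> V" "j \<in> V" "c i = c j"
    then have "\<phi> ` star i = \<phi> ` star j" using image_star by metis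
    then have star_eq: "star i = star j"
      using inj_on_image_eq_iff[OF inj star_sub[OF ij(1)] star_sub[OF ij(2)]] by blast
    \<comment> \<open>An edge at \<open>i\<close> that ends outside \<open>j\<close> separates the stars unless \<open>i = j\<close>.\<close>
    have "\<not> V \<subseteq> {i, j}" using card card_mono[of "{i, j}" V] card_insert_le_m1[of 2 "{j}" i] by auto
    then obtain k where "k \<in> V" "k \<noteq> i" "k \<noteq> j" by auto
    then have "{i, k} \<in> star j" using star_eq ij by (auto simp: star_def)
    then show "i = j" using \<open>k \<noteq> j\<close> ij star_iff by auto
  qed
  define \<pi> where "\<pi> v = (if v \<in> V then c v else v)" for v
  have "inj_on \<pi> V" using inj_c by (simp add: \<pi>_def inj_on_def)
  moreover have "\<pi> ` V \<subseteq> V" using c_V by (auto simp: \<pi>_def)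
  ultimately have "bij_betw \<pi> V V"
    using fin by (simp add: bij_betw_def endo_inj_surj)
  then have "\<pi> permutes V" by (rule bij_imp_permutes) (simp add: \<pi>_def)
  moreover have "\<phi> {i, j} = {\<pi> i, \<pi> j}" if ij: "i \<in> V" "j \<in> V" "i \<noteq> j" for i j
  proof -
    have "c i \<noteq> c j" using inj_c ij by (auto dest: inj_onD)
    moreover have "card (\<phi> {i, j}) = 2"
      using maps[of "{i, j}"] ij by (simp add: nsets_def)
    ultimately show ?thesis
      using c_in[OF ij] ij by (auto simp: \<pi>_def card_2_iff)
  qed
  ultimately show ?thesis by blast
qed

section \<open>Permutations whose edge images meet\<close>

text \<open>
  If \<open>\<pi> j \<noteq> \<rho> j\<close>, choose \<open>i\<close> so that \<open>\<pi> i\<close> misses \<open>\<rho> j\<close>, and then \<open>k\<close> so that \<open>\<rho> k\<close> misses both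
  \<open>\<pi> i\<close> and \<open>\<pi> j\<close>. The choice of \<open>k\<close> has to avoid up to four points; this is where five points are
  used.
\<close>

lemma permutations_eq_if_images_meet:
  assumes "finite V" and card: "card V \<ge> 5"
    and \<pi>: "\<pi> permutes V" and \<rho>: "\<rho> permutes V"
    and meet: "\<And>i j k. {i, j, k} \<subseteq> V \<Longrightarrow> distinct [i, j, k] \<Longrightarrow>
      {\<pi> i, \<pi> j} \<inter> {\<rho> j, \<rho> k} \<noteq> {}"
  shows "\<pi> = \<rho>"
proof
  fix j
  have avoid: "\<exists>v\<in>V. v \<notin> set xs" if "length xs \<le> 4" for xs
  proof -
    have "\<not> V \<subseteq> set xs" using card card_mono[of "set xs" V] card_length[of xs] that by auto
    then show ?thesis by blast
  qed
  show "\<pi> j = \<rho> j"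
  proof (cases "j \<in> V")
    case False
    then show ?thesis using \<pi> \<rho> by (simp add: permutes_not_in)
  next
    case True
    show ?thesis
    proof (rule ccontr)
      assume neq: "\<pi> j \<noteq> \<rho> j"
      obtain i where i: "i \<in> V" "i \<noteq> j" "i \<noteq> inv \<pi> (\<rho> j)"
        using avoid[of "[j, inv \<pi> (\<rho> j)]"] by auto
      obtain k where k: "k \<in> V" "k \<noteq> j" "k \<noteq> i" "k \<noteq> inv \<rho> (\<pi> i)" "k \<noteq> inv \<rho> (\<pi> j)"
        using avoid[of "[j, i, inv \<rho> (\<pi> i), inv \<rho> (\<pi> j)]"] by auto
      have "\<pi> i \<noteq> \<rho> j" "\<rho> k \<noteq> \<pi> i" "\<rho> k \<noteq> \<pi> j"
        using i k permutes_inverses(2)[OF \<pi>] permutes_inverses(2)[OF \<rho>] by metis+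
      with neq meet[of i j k] i k True show False by auto
    qed
  qed
qed

section \<open>From distributions to permutations of the nodes\<close>

lemma edges_eq_nsets: "edges n = [{1..n}]\<^bsup>2\<^esup>"
  by (auto simp: edges_def nsets_def intro: finite_subset)

lemma finite_triples: "finite (triples n)"
  by (rule finite_subset[of _ "{1..n} \<times> {1..n} \<times> {1..n}"]) (auto simp: triples_def)

lemma set_mset_alpha_distribution:
  "set_mset (alpha_distribution n l l' g) = (\<lambda>(i, j, k). alpha l l' g i j k) ` triples n"
  by (simp add: alpha_distribution_def finite_triples)

text \<open>
  This is how the inequalities between sums enter: if the weights of two adjacent edges of \<open>G'\<close> are
  those of \<open>e\<close> and \<open>f\<close> in \<open>G\<close>, their sum occurs among the sums over adjacent edges of \<open>G\<close>, and so \<open>e\<close>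
  and \<open>f\<close> cannot be disjoint. The case \<open>l = l'\<close> serves to find the permutation for one coordinate, the case
  \<open>l' = l + 1\<close> to compare two coordinates.
\<close>

lemma edges_meet:
  assumes sums: "\<And>i j k m p q r. {i, j, k} \<subseteq> {1..n} \<Longrightarrow> distinct [i, j, k] \<Longrightarrow>
      {m, p, q, r} \<subseteq> {1..n} \<Longrightarrow> distinct [m, p, q, r] \<Longrightarrow>
      g {i, j} l + g {j, k} l' \<noteq> g {m, p} l + g {q, r} l'"
    and dist: "alpha_distribution n l l' g' = alpha_distribution n l l' g"
    and ijk: "{i, j, k} \<subseteq> {1..n}" "distinct [i, j, k]"
    and e: "e \<in> edges n" "g' {i, j} l = g e l"
    and f: "f \<in> edges n" "g' {j, k} l' = g f l'"
  shows "e \<inter> f \<noteq> {}"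
proof
  assume disj: "e \<inter> f = {}"
  obtain m p where mp: "e = {m, p}" "m \<in> {1..n}" "p \<in> {1..n}" "m \<noteq> p"
    using e(1) unfolding edges_eq_nsets by (rule nsets2_E)
  obtain q r where qr: "f = {q, r}" "q \<in> {1..n}" "r \<in> {1..n}" "q \<noteq> r"
    using f(1) unfolding edges_eq_nsets by (rule nsets2_E)
  have "alpha l l' g' i j k \<in># alpha_distribution n l l' g'"
    using ijk unfolding set_mset_alpha_distribution by (force simp: triples_def)
  then have "alpha l l' g' i j k \<in> (\<lambda>(i, j, k). alpha l l' g i j k) ` triples n"
    unfolding dist set_mset_alpha_distribution .
  then obtain a b c where abc: "{a, b, c} \<subseteq> {1..n}" "distinct [a, b, c]"
    and "alpha l l' g' i j k = alpha l l' g a b c"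
    by (auto simp: triples_def)
  then have "g {a, b} l + g {b, c} l' = g {m, p} l + g {q, r} l'"
    using e f mp qr by (simp add: alpha_def)
  moreover have "distinct [m, p, q, r]" using disj mp qr by auto
  moreover have "{m, p, q, r} \<subseteq> {1..n}" using mp qr by auto
  ultimately show False using sums[OF abc, of m p q r] by blast
qed

lemma single_coordinate_permutation:
  assumes n: "n \<ge> 5"
    and sums: "\<And>i j k m p q r. {i, j, k} \<subseteq> {1..n} \<Longrightarrow> distinct [i, j, k] \<Longrightarrow>
      {m, p, q, r} \<subseteq> {1..n} \<Longrightarrow> distinct [m, p, q, r] \<Longrightarrow>
      g {i, j} l + g {j, k} l \<noteq> g {m, p} l + g {q, r} l"
    and edge_dist: "edge_distribution n l g' = edge_distribution n l g"
    and alpha_dist: "alpha_distribution n l l g' = alpha_distribution n l l g"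
  shows "\<exists>\<pi>. \<pi> permutes {1..n} \<and>
    (\<forall>i\<in>{1..n}. \<forall>j\<in>{1..n}. i \<noteq> j \<longrightarrow> g' {i, j} l = g {\<pi> i, \<pi> j} l)"
proof -
  have fin: "finite (edges n)"
    by (simp add: edges_eq_nsets finite_imp_finite_nsets)
  have "image_mset (\<lambda>e. g' e l) (mset_set (edges n)) = image_mset (\<lambda>e. g e l) (mset_set (edges n))"
    using edge_dist by (simp add: edge_distribution_def)
  then obtain \<phi> where \<phi>: "\<phi> permutes edges n" and weight: "\<forall>e\<in>edges n. g' e l = g (\<phi> e) l"
    by (rule image_mset_eq_implies_permutes[OF fin])
  have maps: "\<phi> e \<in> edges n" if "e \<in> edges n" for e
    using \<phi> that by (simp add: permutes_in_image)
  have adj: "\<phi> e \<inter> \<phi> f \<noteq> {}" if ef: "e \<in> edges n" "f \<in> edges n" "e \<inter> f \<noteq> {}" for e f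
  proof (cases "e = f")
    case True
    then show ?thesis using maps[OF ef(1)] by (auto simp: edges_def)
  next
    case False
    obtain j where j: "j \<in> e" "j \<in> f" using ef(3) by blast
    obtain i where e: "e = {i, j}" "i \<noteq> j"
      using ef(1) j(1) unfolding edges_def by (auto simp: card_2_iff doubleton_eq_iff)
    obtain k where f: "f = {j, k}" "k \<noteq> j"
      using ef(2) j(2) unfolding edges_def by (auto simp: card_2_iff doubleton_eq_iff)
    have "{i, j, k} \<subseteq> {1..n}" "distinct [i, j, k]"
      using ef(1,2) e f False by (auto simp: edges_def)
    then show ?thesis
      using edges_meet[OF sums alpha_dist _ _ maps[OF ef(1)] _ maps[OF ef(2)], of i j k]
        weight ef(1,2) e f by blast
  qed
  have "\<exists>\<pi>. \<pi> permutes {1..n} \<and>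
      (\<forall>i\<in>{1..n}. \<forall>j\<in>{1..n}. i \<noteq> j \<longrightarrow> \<phi> {i, j} = {\<pi> i, \<pi> j})"
  proof (rule adjacency_preserving_induced)
    show "inj_on \<phi> ([{1..n}]\<^bsup>2\<^esup>)" using \<phi> by (rule permutes_inj_on)
  qed (use n maps adj in \<open>auto simp: edges_eq_nsets\<close>)
  then obtain \<pi> where \<pi>: "\<pi> permutes {1..n}"
    and induced: "\<forall>i\<in>{1..n}. \<forall>j\<in>{1..n}. i \<noteq> j \<longrightarrow> \<phi> {i, j} = {\<pi> i, \<pi> j}" by blast
  have "g' {i, j} l = g {\<pi> i, \<pi> j} l" if "i \<in> {1..n}" "j \<in> {1..n}" "i \<noteq> j" for i j
    using that induced weight by (simp add: edges_eq_nsets)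
  with \<pi> show ?thesis by blast
qed

section \<open>Reconstruction\<close>

theorem theorem3p5:
  fixes n d :: nat and g :: edge_weights
  assumes "d \<ge> 1" and "n \<ge> 5"
    and "\<And>i j k m p q r l.
      {i, j, k} \<subseteq> {1..n} \<Longrightarrow> distinct [i, j, k] \<Longrightarrow>
      {m, p, q, r} \<subseteq> {1..n} \<Longrightarrow> distinct [m, p, q, r] \<Longrightarrow> l \<in> {1..d} \<Longrightarrow>
      g {i, j} l + g {j, k} l \<noteq> g {m, p} l + g {q, r} l"
    and "\<And>i j k m p q r l.
      {i, j, k} \<subseteq> {1..n} \<Longrightarrow> distinct [i, j, k] \<Longrightarrow>
      {m, p, q, r} \<subseteq> {1..n} \<Longrightarrow> distinct [m, p, q, r] \<Longrightarrow> l \<in> {1..d - 1} \<Longrightarrow>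
      g {i, j} l + g {j, k} (l + 1) \<noteq> g {m, p} l + g {q, r} (l + 1)"
  shows "reconstructible n d g
    ({edge_distribution n l | l. l \<in> {1..d}} \<union>
     {alpha_distribution n l l | l. l \<in> {1..d}} \<union>
     {alpha_distribution n l (l + 1) | l. l \<in> {1..d - 1}})"
  unfolding reconstructible_def
proof (intro allI impI)
  fix g'
  assume same: "\<forall>D\<in>{edge_distribution n l | l. l \<in> {1..d}} \<union>
     {alpha_distribution n l l | l. l \<in> {1..d}} \<union>
     {alpha_distribution n l (l + 1) | l. l \<in> {1..d - 1}}. D g' = D g"
  have edge_dist: "edge_distribution n l g' = edge_distribution n l g" if "l \<in> {1..d}" for l
    using same that by blast
  have alpha_dist: "alpha_distribution n l l g' = alpha_distribution n l l g" if "l \<in> {1..d}" for l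
    using same that by blast
  have mixed_dist: "alpha_distribution n l (l + 1) g' = alpha_distribution n l (l + 1) g"
    if "l \<in> {1..d - 1}" for l
    using same that by blast

  have "\<exists>\<pi>. \<pi> permutes {1..n} \<and>
      (\<forall>i\<in>{1..n}. \<forall>j\<in>{1..n}. i \<noteq> j \<longrightarrow> g' {i, j} l = g {\<pi> i, \<pi> j} l)" if "l \<in> {1..d}" for l
    using single_coordinate_permutation[OF assms(2) assms(3)[OF _ _ _ _ that]
        edge_dist[OF that] alpha_dist[OF that]] .
  then obtain \<pi> where \<pi>: "\<And>l. l \<in> {1..d} \<Longrightarrow> \<pi> l permutes {1..n}"
    and weight: "\<And>l i j. l \<in> {1..d} \<Longrightarrow> i \<in> {1..n} \<Longrightarrow> j \<in> {1..n} \<Longrightarrow> i \<noteq> j \<Longrightarrow>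
      g' {i, j} l = g {\<pi> l i, \<pi> l j} l"
    by metis

  have image_edge: "{\<pi> l i, \<pi> l j} \<in> edges n"
    if "l \<in> {1..d}" "i \<in> {1..n}" "j \<in> {1..n}" "i \<noteq> j" for l i j
  proof -
    have "\<pi> l i \<in> {1..n}" "\<pi> l j \<in> {1..n}"
      using that permutes_in_image[OF \<pi>[OF that(1)]] by blast+
    moreover have "\<pi> l i \<noteq> \<pi> l j"
      using that permutes_inj[OF \<pi>[OF that(1)]] by (auto dest: injD)
    ultimately show ?thesis by (simp add: edges_eq_nsets)
  qed
  have consecutive: "\<pi> l = \<pi> (l + 1)" if l: "l \<in> {1..d - 1}" for l
  proof (rule permutations_eq_if_images_meet)
    have l': "l \<in> {1..d}" "l + 1 \<in> {1..d}" using l by auto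
    show "\<pi> l permutes {1..n}" "\<pi> (l + 1) permutes {1..n}" using \<pi> l' by blast+
    fix i j k assume ijk: "{i, j, k} \<subseteq> {1..n}" "distinct [i, j, k]"
    show "{\<pi> l i, \<pi> l j} \<inter> {\<pi> (l + 1) j, \<pi> (l + 1) k} \<noteq> {}"
      using ijk l'
      by (intro edges_meet[OF assms(4)[OF _ _ _ _ l] mixed_dist[OF l] ijk] image_edge weight) auto
  qed (use assms(2) in simp_all)
  have all_equal: "\<pi> l = \<pi> 1" if "1 \<le> l" "l \<le> d" for l
    using that
  proof (induction l rule: dec_induct)
    case (step l)
    then show ?case using consecutive[of l] by simp
  qed simp
  show "isomorphic n d g g'"
    unfolding isomorphic_def
  proof (intro exI conjI ballI impI)
    show "\<pi> 1 permutes {1..n}" using \<pi> assms(1) by simp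
    fix i j l assume "i \<in> {1..n}" "j \<in> {1..n}" "i \<noteq> j" "l \<in> {1..d}"
    then show "g' {i, j} l = g {\<pi> 1 i, \<pi> 1 j} l"
      using weight[of l i j] all_equal[of l] by simp
  qed
qed

end
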